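(* Let $W$ be a right-angled Coxeter group (of finite rank). Then $W[2]=W$ and $W[4]=W'$, where $W'$ is the commutator subgroup of $W$.
   Context: A right-angled Coxeter group $W$ of finite rank $r$ is given with a Coxeter system $S=\{w_1,\dots,w_r\}$ and presentation $\langle S\mid (w_iw_j)^{m_{i,j}}=1\rangle$, where $m_{i,j}=m_{j,i}$, $m_{i,i}=1$ and $m_{i,j}\in\{2,\infty\}$ for $i\ne j$ (no relation is imposed when $m_{i,j}=\infty$). Tits representation: let $V$ be the real vector space with basis $e_1,\dots,e_r$, and let $B$ be the symmetric bilinear form with $B(e_i,e_j)=-\cos(\pi/m_{i,j})$ if $m_{i,j}\neq\infty$ and $B(e_i,e_j)=-1$ if $m_{i,j}=\infty$. The Tits representation $\rho:W\to \mathrm{GL}(V)$ is given by $\rho(w_i)(v)=v-2B(e_i,v)e_i$. In the basis $e_1,\dots,e_r$ its matrices have integer entries, so $\rho:W\to \mathrm{GL}(r,\mathbb{Z})$. For $m\ge 2$, $W[m]$ is the kernel of the composition of $\rho$ with the reduction $\mathrm{GL}(r,\mathbb{Z})\to \mathrm{GL}(r,\mathbb{Z}/m\mathbb{Z})$. *)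

theory Defs
  imports
    Complex_Main
    "HOL-Library.Extended_Nat"
    "HOL-Algebra.Generated_Groups"
    "Jordan_Normal_Form.Matrix"
begin

section \<open>Group presentations\<close>

text \<open>A word is a list of letters \<open>(i, b)\<close>, where \<open>(i, True)\<close> stands for the generator with
  index \<open>i\<close> and \<open>(i, False)\<close> for its formal inverse.\<close>

type_synonym 'i word = "('i \<times> bool) list"

definition words :: "'i set \<Rightarrow> 'i word set" where
  "words I = lists (I \<times> UNIV)"

fun eval_word :: "('a, 'b) monoid_scheme \<Rightarrow> ('i \<Rightarrow> 'a) \<Rightarrow> 'i word \<Rightarrow> 'a" where
  "eval_word G f [] = \<one>\<^bsub>G\<^esub>"
| "eval_word G f ((i, b) # u) = (if b then f i else inv\<^bsub>G\<^esub> (f i)) \<otimes>\<^bsub>G\<^esub> eval_word G f u"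

text \<open>Equality of words in the group with generators \<open>I\<close> and relators \<open>R\<close>.\<close>

inductive word_eq :: "'i set \<Rightarrow> 'i word set \<Rightarrow> 'i word \<Rightarrow> 'i word \<Rightarrow> bool"
  for I :: "'i set" and R :: "'i word set" where
  refl: "u \<in> words I \<Longrightarrow> word_eq I R u u"
| sym: "word_eq I R u v \<Longrightarrow> word_eq I R v u"
| trans: "word_eq I R u v \<Longrightarrow> word_eq I R v x \<Longrightarrow> word_eq I R u x"
| cancel: "u \<in> words I \<Longrightarrow> v \<in> words I \<Longrightarrow> i \<in> I
    \<Longrightarrow> word_eq I R (u @ [(i, b), (i, \<not> b)] @ v) (u @ v)"
| relator: "u \<in> words I \<Longrightarrow> v \<in> words I \<Longrightarrow> x \<in> R \<Longrightarrow> x \<in> words I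
    \<Longrightarrow> word_eq I R (u @ x @ v) (u @ v)"

text \<open>\<open>G\<close> is presented by the generators \<open>f i\<close> (for \<open>i \<in> I\<close>) and the relators \<open>R\<close>: the canonical
  map from the free group on \<open>I\<close> is onto \<open>G\<close> and its kernel is the normal closure of \<open>R\<close>.\<close>

definition has_presentation ::
    "('a, 'b) monoid_scheme \<Rightarrow> 'i set \<Rightarrow> ('i \<Rightarrow> 'a) \<Rightarrow> 'i word set \<Rightarrow> bool" where
  "has_presentation G I f R \<longleftrightarrow>
     group G \<and> f \<in> I \<rightarrow> carrier G \<and> generate G (f ` I) = carrier G \<and>
     (\<forall>u \<in> words I. eval_word G f u = \<one>\<^bsub>G\<^esub> \<longleftrightarrow> word_eq I R u [])"

section \<open>Right-angled Coxeter groups\<close>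

text \<open>The generators \<open>w\<^sub>1, \<dots>, w\<^sub>r\<close> are indexed by \<open>0, \<dots>, r - 1\<close>.\<close>

definition coxeter_matrix :: "nat \<Rightarrow> (nat \<Rightarrow> nat \<Rightarrow> enat) \<Rightarrow> bool" where
  "coxeter_matrix r m \<longleftrightarrow>
     (\<forall>i<r. m i i = 1) \<and> (\<forall>i<r. \<forall>j<r. m i j = m j i) \<and> (\<forall>i<r. \<forall>j<r. i \<noteq> j \<longrightarrow> 2 \<le> m i j)"

definition coxeter_relators :: "nat \<Rightarrow> (nat \<Rightarrow> nat \<Rightarrow> enat) \<Rightarrow> nat word set" where
  "coxeter_relators r m =
     {concat (replicate n [(i, True), (j, True)]) |i j n. i < r \<and> j < r \<and> m i j = enat n}"

definition coxeter_system ::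
    "('a, 'b) monoid_scheme \<Rightarrow> nat \<Rightarrow> (nat \<Rightarrow> 'a) \<Rightarrow> (nat \<Rightarrow> nat \<Rightarrow> enat) \<Rightarrow> bool" where
  "coxeter_system G r w m \<longleftrightarrow>
     coxeter_matrix r m \<and> has_presentation G {..<r} w (coxeter_relators r m)"

definition right_angled_coxeter_system ::
    "('a, 'b) monoid_scheme \<Rightarrow> nat \<Rightarrow> (nat \<Rightarrow> 'a) \<Rightarrow> (nat \<Rightarrow> nat \<Rightarrow> enat) \<Rightarrow> bool" where
  "right_angled_coxeter_system G r w m \<longleftrightarrow>
     coxeter_system G r w m \<and> (\<forall>i<r. \<forall>j<r. i \<noteq> j \<longrightarrow> m i j \<in> {2, \<infinity>})"

section \<open>The Tits representation\<close>

definition tits_gram :: "nat \<Rightarrow> (nat \<Rightarrow> nat \<Rightarrow> enat) \<Rightarrow> real mat" where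
  "tits_gram r m =
     mat r r (\<lambda>(i, j). case m i j of enat n \<Rightarrow> - cos (pi / real n) | \<infinity> \<Rightarrow> - 1)"

definition tits_form :: "nat \<Rightarrow> (nat \<Rightarrow> nat \<Rightarrow> enat) \<Rightarrow> real vec \<Rightarrow> real vec \<Rightarrow> real" where
  "tits_form r m u v = u \<bullet> (tits_gram r m *\<^sub>v v)"

definition tits_reflection ::
    "nat \<Rightarrow> (nat \<Rightarrow> nat \<Rightarrow> enat) \<Rightarrow> nat \<Rightarrow> real vec \<Rightarrow> real vec" where
  "tits_reflection r m i v = v - (2 * tits_form r m (unit_vec r i) v) \<cdot>\<^sub>v unit_vec r i"

text \<open>The matrix of the reflection with respect to the basis \<open>e\<^sub>1, \<dots>, e\<^sub>r\<close>: its columns are the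
  images of the basis vectors.\<close>

definition tits_reflection_mat :: "nat \<Rightarrow> (nat \<Rightarrow> nat \<Rightarrow> enat) \<Rightarrow> nat \<Rightarrow> real mat" where
  "tits_reflection_mat r m i =
     mat_of_cols r (map (\<lambda>j. tits_reflection r m i (unit_vec r j)) [0..<r])"

definition GL :: "'c :: comm_ring_1 itself \<Rightarrow> nat \<Rightarrow> 'c mat monoid" where
  "GL ty r = units_of (ring_mat ty r ())"

text \<open>Functions on \<open>carrier G\<close> are made unique by taking them to be extensional. Existence and
  uniqueness for right-angled systems is lemma \<open>tits_rep_ex1\<close> below.\<close>

definition tits_rep ::
    "('a, 'b) monoid_scheme \<Rightarrow> nat \<Rightarrow> (nat \<Rightarrow> 'a) \<Rightarrow> (nat \<Rightarrow> nat \<Rightarrow> enat) \<Rightarrow> 'a \<Rightarrow> real mat" where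
  "tits_rep G r w m =
     (THE \<rho>. \<rho> \<in> hom G (GL TYPE(real) r) \<and> \<rho> \<in> extensional (carrier G) \<and>
             (\<forall>i<r. \<rho> (w i) = tits_reflection_mat r m i))"

text \<open>The Tits representation as a homomorphism to \<open>GL(r, \<int>)\<close>; see lemma \<open>tits_rep_int\<close> below.\<close>

definition tits_rep_int ::
    "('a, 'b) monoid_scheme \<Rightarrow> nat \<Rightarrow> (nat \<Rightarrow> 'a) \<Rightarrow> (nat \<Rightarrow> nat \<Rightarrow> enat) \<Rightarrow> 'a \<Rightarrow> int mat" where
  "tits_rep_int G r w m g =
     (THE A. A \<in> carrier_mat r r \<and> map_mat real_of_int A = tits_rep G r w m g)"

section \<open>Congruence subgroups\<close>

text \<open>Matrices over \<open>\<int>/k\<int>\<close> are represented by integer matrices with entries in \<open>{0..<k}\<close>.\<close>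

definition mat_mod :: "nat \<Rightarrow> int mat \<Rightarrow> int mat" where
  "mat_mod k A = map_mat (\<lambda>a. a mod int k) A"

definition residue_mat_monoid :: "nat \<Rightarrow> nat \<Rightarrow> int mat monoid" where
  "residue_mat_monoid r k =
     \<lparr>carrier = {A \<in> carrier_mat r r. \<forall>i<r. \<forall>j<r. A $$ (i, j) \<in> {0..<int k}},
      monoid.mult = (\<lambda>A B. mat_mod k (A * B)),
      one = mat_mod k (1\<^sub>m r)\<rparr>"

definition GL_residue :: "nat \<Rightarrow> nat \<Rightarrow> int mat monoid" where
  "GL_residue r k = units_of (residue_mat_monoid r k)"

definition congruence_subgroup ::
    "('a, 'b) monoid_scheme \<Rightarrow> nat \<Rightarrow> (nat \<Rightarrow> 'a) \<Rightarrow> (nat \<Rightarrow> nat \<Rightarrow> enat) \<Rightarrow> nat \<Rightarrow> 'a set" where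
  "congruence_subgroup G r w m k =
     kernel G (GL_residue r k) (\<lambda>g. mat_mod k (tits_rep_int G r w m g))"

section \<open>Well-definedness of the Tits representation of a right-angled system\<close>

lemma (in group) eval_word_closed:
  "f \<in> I \<rightarrow> carrier G \<Longrightarrow> u \<in> words I \<Longrightarrow> eval_word G f u \<in> carrier G"
  by (induction u) (auto simp: words_def Pi_iff)

lemma (in group) eval_word_append:
  assumes f: "f \<in> I \<rightarrow> carrier G" and "u \<in> words I" "v \<in> words I"
  shows "eval_word G f (u @ v) = eval_word G f u \<otimes> eval_word G f v"
  using assms(2)
proof (induction u)
  case Nil
  then show ?case using eval_word_closed[OF f assms(3)] by simp
next
  case (Cons a u)
  obtain i b where a: "a = (i, b)" by (cases a)
  have i: "f i \<in> carrier G" and u: "u \<in> words I" using Cons.prems f by (auto simp: words_def a)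
  show ?case using Cons.IH[OF u] i eval_word_closed[OF f u] eval_word_closed[OF f assms(3)]
    by (auto simp: a m_assoc)
qed

definition inv_word :: "'i word \<Rightarrow> 'i word" where
  "inv_word u = rev (map (\<lambda>(i, b). (i, \<not> b)) u)"

lemma inv_word_in_words: "u \<in> words I \<Longrightarrow> inv_word u \<in> words I"
  by (auto simp: inv_word_def words_def)

lemma words_append [simp]: "u @ v \<in> words I \<longleftrightarrow> u \<in> words I \<and> v \<in> words I"
  by (auto simp: words_def)

lemma (in group) eval_word_inv:
  assumes f: "f \<in> I \<rightarrow> carrier G" and "u \<in> words I"
  shows "eval_word G f (inv_word u) = inv (eval_word G f u)"
  using assms(2)
proof (induction u)
  case Nil
  then show ?case by (simp add: inv_word_def)
next
  case (Cons a u)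
  obtain i b where a: "a = (i, b)" by (cases a)
  have i: "f i \<in> carrier G" and u: "u \<in> words I" and ib: "[(i, \<not> b)] \<in> words I"
    using Cons.prems f by (auto simp: words_def a)
  have "inv_word (a # u) = inv_word u @ [(i, \<not> b)]" by (simp add: inv_word_def a)
  then have "eval_word G f (inv_word (a # u)) =
      eval_word G f (inv_word u) \<otimes> eval_word G f [(i, \<not> b)]"
    using eval_word_append[OF f inv_word_in_words[OF u] ib] by simp
  then show ?case using Cons.IH[OF u] i eval_word_closed[OF f u]
    by (auto simp: a inv_mult_group)
qed

lemma word_eq_words: "word_eq I R u v \<Longrightarrow> u \<in> words I \<and> v \<in> words I"
  by (induction rule: word_eq.induct) (auto simp: words_def)

lemma (in group) eval_word_eq:
  assumes f: "f \<in> I \<rightarrow> carrier G"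
    and R: "\<And>x. x \<in> R \<Longrightarrow> x \<in> words I \<Longrightarrow> eval_word G f x = \<one>"
    and "word_eq I R u v"
  shows "eval_word G f u = eval_word G f v"
  using assms(3)
proof (induction rule: word_eq.induct)
  case (cancel u v i b)
  have i: "f i \<in> carrier G" using f cancel by auto
  have w: "[(i, b), (i, \<not> b)] \<in> words I" using cancel by (auto simp: words_def)
  then have wv: "[(i, b), (i, \<not> b)] @ v \<in> words I" using cancel by (simp only: words_append)
  have "eval_word G f [(i, b), (i, \<not> b)] = \<one>" using i by (cases b) auto
  then show ?case
    using eval_word_append[OF f cancel(1) wv]
      eval_word_append[OF f w cancel(2)] eval_word_append[OF f cancel(1,2)]
      eval_word_closed[OF f cancel(2)] by (simp del: append.append_Cons eval_word.simps(2))
next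
  case (relator u v x)
  then show ?case
    using eval_word_append[OF f relator(1), of "x @ v"]
      eval_word_append[OF f relator(4,2)] eval_word_append[OF f relator(1,2)]
      eval_word_closed[OF f relator(2)] R by simp
qed auto

lemma (in group) generate_eval_word:
  assumes f: "f \<in> I \<rightarrow> carrier G" and "g \<in> generate G (f ` I)"
  shows "\<exists>u \<in> words I. g = eval_word G f u"
  using assms(2)
proof (induction rule: generate.induct)
  case one
  show ?case by (rule bexI[of _ "[]"]) (auto simp: words_def)
next
  case (incl h)
  then obtain i where "i \<in> I" "h = f i" by auto
  then show ?case using f by (intro bexI[of _ "[(i, True)]"]) (auto simp: words_def Pi_iff)
next
  case (inv h)
  then obtain i where "i \<in> I" "h = f i" by auto
  then show ?case using f by (intro bexI[of _ "[(i, False)]"]) (auto simp: words_def Pi_iff)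
next
  case (eng h1 h2)
  then obtain u v where "u \<in> words I" "v \<in> words I" "h1 = eval_word G f u" "h2 = eval_word G f v"
    by auto
  then show ?case using eval_word_append[OF f, of u v] by (intro bexI[of _ "u @ v"]) auto
qed

lemma hom_eval_word:
  assumes "group G" "group H" "h \<in> hom G H" and f: "f \<in> I \<rightarrow> carrier G" and "u \<in> words I"
  shows "h (eval_word G f u) = eval_word H (\<lambda>i. h (f i)) u"
proof -
  interpret group_hom G H h using assms by (simp add: group_hom_def group_hom_axioms_def)
  show ?thesis using assms(5)
  proof (induction u)
    case (Cons a u)
    obtain i b where a: "a = (i, b)" by (cases a)
    have i: "f i \<in> carrier G" and u: "u \<in> words I" using Cons.prems f by (auto simp: words_def a)
    then show ?case using Cons.IH[OF u] G.eval_word_closed[OF f u] by (auto simp: a)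
  qed simp
qed

text \<open>The universal property of a presentation.\<close>

lemma has_presentation_hom:
  assumes pres: "has_presentation G I f R" and H: "group H" and h: "h \<in> I \<rightarrow> carrier H"
    and R: "\<And>x. x \<in> R \<Longrightarrow> x \<in> words I \<Longrightarrow> eval_word H h x = \<one>\<^bsub>H\<^esub>"
  shows "\<exists>!\<phi>. \<phi> \<in> hom G H \<and> \<phi> \<in> extensional (carrier G) \<and> (\<forall>i\<in>I. \<phi> (f i) = h i)"
proof -
  interpret G: group G using pres by (simp add: has_presentation_def)
  interpret H: group H by fact
  have f: "f \<in> I \<rightarrow> carrier G" and gen: "generate G (f ` I) = carrier G"
    and ker: "\<And>u. u \<in> words I \<Longrightarrow> eval_word G f u = \<one>\<^bsub>G\<^esub> \<longleftrightarrow> word_eq I R u []"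
    using pres by (auto simp: has_presentation_def)
  have ex: "\<exists>u \<in> words I. g = eval_word G f u" if "g \<in> carrier G" for g
    using G.generate_eval_word[OF f] that gen by simp
  have wd: "eval_word H h u = eval_word H h v"
    if u: "u \<in> words I" and v: "v \<in> words I" and eq: "eval_word G f u = eval_word G f v" for u v
  proof -
    have "eval_word G f (inv_word u @ v) = \<one>\<^bsub>G\<^esub>"
      using G.eval_word_append[OF f inv_word_in_words[OF u] v] G.eval_word_inv[OF f u]
        G.eval_word_closed[OF f v] eq by simp
    then have "word_eq I R (inv_word u @ v) []"
      using ker[of "inv_word u @ v"] u v by (simp add: inv_word_in_words)
    then have "eval_word H h (inv_word u @ v) = \<one>\<^bsub>H\<^esub>"
      using H.eval_word_eq[OF h R] by fastforce
    then have "inv\<^bsub>H\<^esub> (eval_word H h u) \<otimes>\<^bsub>H\<^esub> eval_word H h v = \<one>\<^bsub>H\<^esub>"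
      using H.eval_word_append[OF h inv_word_in_words[OF u] v] H.eval_word_inv[OF h u] by simp
    then show ?thesis
      using H.eval_word_closed[OF h u] H.eval_word_closed[OF h v]
      by (metis H.inv_closed H.inv_equality H.inv_inv)
  qed
  define \<phi> where "\<phi> = (\<lambda>g \<in> carrier G. eval_word H h (SOME u. u \<in> words I \<and> g = eval_word G f u))"
  have \<phi>: "\<phi> (eval_word G f u) = eval_word H h u" if u: "u \<in> words I" for u
  proof -
    let ?v = "SOME v. v \<in> words I \<and> eval_word G f u = eval_word G f v"
    have "?v \<in> words I \<and> eval_word G f u = eval_word G f ?v"
      by (rule someI[of _ u]) (use u in auto)
    then show ?thesis using wd[of ?v u] u G.eval_word_closed[OF f u] by (simp add: \<phi>_def)
  qed
  have hom: "\<phi> \<in> hom G H"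
  proof (rule homI)
    fix g assume "g \<in> carrier G"
    then show "\<phi> g \<in> carrier H" using ex[of g] \<phi> H.eval_word_closed[OF h] by auto
  next
    fix g g' assume "g \<in> carrier G" "g' \<in> carrier G"
    then obtain u v where uv: "u \<in> words I" "v \<in> words I" "g = eval_word G f u" "g' = eval_word G f v"
      using ex by meson
    then show "\<phi> (g \<otimes>\<^bsub>G\<^esub> g') = \<phi> g \<otimes>\<^bsub>H\<^esub> \<phi> g'"
      using G.eval_word_append[OF f uv(1,2)] H.eval_word_append[OF h uv(1,2)] \<phi>[of "u @ v"] \<phi>
      by simp
  qed
  have gens: "\<phi> (f i) = h i" if i: "i \<in> I" for i
  proof -
    have "f i \<in> carrier G" "h i \<in> carrier H" using f h i by auto
    then show ?thesis using \<phi>[of "[(i, True)]"] i by (simp add: words_def)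
  qed
  show ?thesis
  proof (rule ex1I[of _ \<phi>])
    show "\<phi> \<in> hom G H \<and> \<phi> \<in> extensional (carrier G) \<and> (\<forall>i\<in>I. \<phi> (f i) = h i)"
      using hom gens by (auto simp: \<phi>_def)
  next
    fix \<psi> assume \<psi>: "\<psi> \<in> hom G H \<and> \<psi> \<in> extensional (carrier G) \<and> (\<forall>i\<in>I. \<psi> (f i) = h i)"
    show "\<psi> = \<phi>"
    proof (rule extensionalityI[of _ "carrier G"])
      fix g assume "g \<in> carrier G"
      then obtain u where u: "u \<in> words I" "g = eval_word G f u" using ex by auto
      have "eval_word H (\<lambda>i. \<psi> (f i)) u = eval_word H h u"
        using u(1) \<psi> by (induction u) (auto simp: words_def)
      then show "\<psi> g = \<phi> g"
        using hom_eval_word[OF G.group_axioms H _ f u(1), of \<psi>] \<psi> \<phi> u by simp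
    qed (use \<psi> in \<open>auto simp: \<phi>_def\<close>)
  qed
qed

lemma group_GL: "group (GL TYPE('c :: comm_ring_1) r)"
proof -
  interpret ring "ring_mat TYPE('c) r ()" by (rule ring_mat)
  show ?thesis unfolding GL_def by (rule units_group)
qed

lemma GL_mult [simp]: "A \<otimes>\<^bsub>GL ty r\<^esub> B = A * B"
  and GL_one [simp]: "\<one>\<^bsub>GL ty r\<^esub> = 1\<^sub>m r"
  by (simp_all add: GL_def units_of_def ring_mat_def)

lemma GL_carrier:
  "A \<in> carrier (GL TYPE('c :: comm_ring_1) r) \<longleftrightarrow>
     A \<in> carrier_mat r r \<and> (\<exists>B \<in> carrier_mat r r. B * A = 1\<^sub>m r \<and> A * B = 1\<^sub>m r)"
  by (auto simp: GL_def units_of_def ring_mat_def Units_def)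

text \<open>The reflection matrices have integer entries.\<close>

definition gram_int :: "(nat \<Rightarrow> nat \<Rightarrow> enat) \<Rightarrow> nat \<Rightarrow> nat \<Rightarrow> int" where
  "gram_int m i j = (if m i j = 1 then 1 else if m i j = 2 then 0 else -1)"

definition refl_int :: "nat \<Rightarrow> (nat \<Rightarrow> nat \<Rightarrow> enat) \<Rightarrow> nat \<Rightarrow> int mat" where
  "refl_int r m i =
     mat r r (\<lambda>(k, l). (if k = l then 1 else 0) - (if k = i then 2 * gram_int m i l else 0))"

lemma refl_int_carrier [simp]: "refl_int r m i \<in> carrier_mat r r"
  by (simp add: refl_int_def)

lemma right_angled_values:
  assumes "right_angled_coxeter_system G r w m" "i < r" "j < r"
  shows "if i = j then m i j = 1 else m i j = 2 \<or> m i j = \<infinity>"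
  using assms by (auto simp: right_angled_coxeter_system_def coxeter_system_def coxeter_matrix_def)

lemma tits_gram_int:
  assumes "right_angled_coxeter_system G r w m" "i < r" "j < r"
  shows "tits_gram r m $$ (i, j) = real_of_int (gram_int m i j)"
proof -
  consider "m i j = enat 1" | "m i j = enat 2" | "m i j = \<infinity>"
    using right_angled_values[OF assms] by (auto simp: one_enat_def numeral_eq_enat split: if_splits)
  then show ?thesis
    by cases (use assms in \<open>auto simp: tits_gram_def gram_int_def one_enat_def numeral_eq_enat\<close>)
qed

lemma tits_reflection_mat_int:
  assumes "right_angled_coxeter_system G r w m" "i < r"
  shows "tits_reflection_mat r m i = map_mat real_of_int (refl_int r m i)"
proof (rule eq_matI)
  fix k l assume "k < dim_row (map_mat real_of_int (refl_int r m i))"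
    "l < dim_col (map_mat real_of_int (refl_int r m i))"
  then have kl: "k < r" "l < r" by (auto simp: refl_int_def)
  have c: "tits_gram r m \<in> carrier_mat r r" by (simp add: tits_gram_def)
  have "tits_form r m (unit_vec r i) (unit_vec r l) = tits_gram r m $$ (i, l)"
    using c kl assms(2) by (simp add: tits_form_def)
  then show "tits_reflection_mat r m i $$ (k, l) = map_mat real_of_int (refl_int r m i) $$ (k, l)"
    using kl assms(2) tits_gram_int[OF assms kl(2)]
    by (auto simp: tits_reflection_mat_def mat_of_cols_def tits_reflection_def refl_int_def)
qed (auto simp: tits_reflection_mat_def refl_int_def)

lemma refl_int_mult:
  assumes "i < r" "j < r"
  shows "refl_int r m i * refl_int r m j = mat r r (\<lambda>(k, l). (if k = l then 1 else 0)
    - (if k = i then 2 * gram_int m i l else 0) - (if k = j then 2 * gram_int m j l else 0)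
    + (if k = i then 4 * gram_int m i j * gram_int m j l else 0))"
proof (rule eq_matI)
  let ?M = "mat r r (\<lambda>(k, l). (if k = l then 1 else 0)
    - (if k = i then 2 * gram_int m i l else 0) - (if k = j then 2 * gram_int m j l else 0)
    + (if k = i then 4 * gram_int m i j * gram_int m j l else 0))"
  fix k l assume "k < dim_row ?M" "l < dim_col ?M"
  then have kl: "k < r" "l < r" by auto
  let ?d = "\<lambda>a b :: nat. if a = b then (1::int) else 0"
  let ?N = "\<lambda>s a b. if a = s then 2 * gram_int m s b else 0"
  have "(refl_int r m i * refl_int r m j) $$ (k, l) =
      (\<Sum>x<r. (?d k x - ?N i k x) * (?d x l - ?N j x l))"
    using kl by (auto simp: refl_int_def scalar_prod_def lessThan_atLeast0 intro!: sum.cong)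
  also have "\<dots> = (\<Sum>x<r. (if x = k then ?d k l - ?N j k l else 0)
      - (if x = l then ?N i k l else 0) + (if x = j then ?N i k j * (2 * gram_int m j l) else 0))"
    by (rule sum.cong) (auto simp: algebra_simps)
  also have "\<dots> = ?d k l - ?N j k l - ?N i k l + ?N i k j * (2 * gram_int m j l)"
    using kl assms by (simp add: sum.distrib sum_subtractf)
  finally show "(refl_int r m i * refl_int r m j) $$ (k, l) = ?M $$ (k, l)"
    using kl by auto
qed (auto simp: refl_int_def)

lemma refl_int_square:
  assumes "right_angled_coxeter_system G r w m" "i < r"
  shows "refl_int r m i * refl_int r m i = 1\<^sub>m r"
  unfolding refl_int_mult[OF assms(2,2)]
  by (rule eq_matI) (use right_angled_values[OF assms assms(2)] in \<open>auto simp: gram_int_def\<close>)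

lemma refl_int_commute:
  assumes "i < r" "j < r" "m i j = 2" "m j i = 2"
  shows "refl_int r m i * refl_int r m j = refl_int r m j * refl_int r m i"
  unfolding refl_int_mult[OF assms(1,2)] refl_int_mult[OF assms(2,1)]
  by (rule eq_matI) (use assms in \<open>auto simp: gram_int_def\<close>)

lemma refl_int_GL:
  assumes "right_angled_coxeter_system G r w m" "i < r"
  shows "refl_int r m i \<in> carrier (GL TYPE(int) r)"
  using refl_int_square[OF assms] by (auto simp: GL_carrier intro!: bexI[of _ "refl_int r m i"])

lemma refl_int_relator:
  assumes ra: "right_angled_coxeter_system G r w m" and x: "x \<in> coxeter_relators r m"
  shows "eval_word (GL TYPE(int) r) (refl_int r m) x = \<one>\<^bsub>GL TYPE(int) r\<^esub>"
proof -
  obtain i j n where ij: "i < r" "j < r" "m i j = enat n"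
    and x: "x = concat (replicate n [(i, True), (j, True)])"
    using x by (auto simp: coxeter_relators_def)
  let ?i = "refl_int r m i" and ?j = "refl_int r m j"
  show ?thesis
  proof (cases "i = j")
    case True
    then have "n = 1" using right_angled_values[OF ra ij(1,2)] ij by (simp add: one_enat_def)
    then show ?thesis
      using True x refl_int_square[OF ra ij(1)] right_mult_one_mat[OF refl_int_carrier] by simp
  next
    case False
    then have n: "n = 2" using right_angled_values[OF ra ij(1,2)] ij by (simp add: numeral_eq_enat)
    then have m: "m i j = 2" "m j i = 2"
      using ij ra by (auto simp: numeral_eq_enat right_angled_coxeter_system_def coxeter_system_def coxeter_matrix_def)
    have "eval_word (GL TYPE(int) r) (refl_int r m) x = ?i * (?j * (?i * ?j))"
      using n x right_mult_one_mat[OF refl_int_carrier] by (simp add: numeral_2_eq_2)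
    also have "\<dots> = ?i * (?j * (?j * ?i))" by (simp only: refl_int_commute[OF ij(1,2) m])
    also have "?j * (?j * ?i) = (?j * ?j) * ?i"
      by (rule assoc_mult_mat[symmetric]) (rule refl_int_carrier)+
    also have "\<dots> = ?i" using refl_int_square[OF ra ij(2)] left_mult_one_mat[OF refl_int_carrier] by simp
    finally show ?thesis using refl_int_square[OF ra ij(1)] by simp
  qed
qed

lemma tits_int_ex1:
  assumes ra: "right_angled_coxeter_system G r w m"
  shows "\<exists>!\<tau>. \<tau> \<in> hom G (GL TYPE(int) r) \<and> \<tau> \<in> extensional (carrier G) \<and>
           (\<forall>i\<in>{..<r}. \<tau> (w i) = refl_int r m i)"
  by (rule has_presentation_hom[where R = "coxeter_relators r m"])
    (use assms refl_int_GL[OF ra] refl_int_relator[OF ra] group_GL in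
      \<open>auto simp: right_angled_coxeter_system_def coxeter_system_def\<close>)

lemma map_mat_GL_hom: "map_mat real_of_int \<in> hom (GL TYPE(int) r) (GL TYPE(real) r)"
proof (rule homI)
  fix A :: "int mat" assume "A \<in> carrier (GL TYPE(int) r)"
  then obtain B where A: "A \<in> carrier_mat r r" and B: "B \<in> carrier_mat r r"
    and "B * A = 1\<^sub>m r" "A * B = 1\<^sub>m r"
    by (auto simp: GL_carrier)
  then have "map_mat real_of_int B * map_mat real_of_int A = 1\<^sub>m r"
    "map_mat real_of_int A * map_mat real_of_int B = 1\<^sub>m r"
    by (metis of_int_hom.mat_hom_mult of_int_hom.mat_hom_one)+
  then show "map_mat real_of_int A \<in> carrier (GL TYPE(real) r)"
    using A B by (auto simp: GL_carrier intro!: bexI[of _ "map_mat real_of_int B"])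
qed (auto simp: GL_carrier of_int_hom.mat_hom_mult)

lemma
  assumes ra: "right_angled_coxeter_system G r w m"
  shows tits_rep_ex1: "\<exists>!\<rho>. \<rho> \<in> hom G (GL TYPE(real) r) \<and> \<rho> \<in> extensional (carrier G) \<and>
      (\<forall>i<r. \<rho> (w i) = tits_reflection_mat r m i)" (is ?A)
    and tits_rep_int: "g \<in> carrier G \<Longrightarrow> map_mat real_of_int (tits_rep_int G r w m g) = tits_rep G r w m g"
    and tits_rep_int_hom: "tits_rep_int G r w m \<in> hom G (GL TYPE(int) r)"
    and tits_rep_int_gen: "i < r \<Longrightarrow> tits_rep_int G r w m (w i) = refl_int r m i"
proof -
  let ?P = "\<lambda>\<rho>. \<rho> \<in> hom G (GL TYPE(real) r) \<and> \<rho> \<in> extensional (carrier G) \<and>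
      (\<forall>i<r. \<rho> (w i) = tits_reflection_mat r m i)"
  have pres: "has_presentation G {..<r} w (coxeter_relators r m)"
    using ra by (simp add: right_angled_coxeter_system_def coxeter_system_def)
  have G: "group G" and w: "\<And>i. i < r \<Longrightarrow> w i \<in> carrier G" using pres by (auto simp: has_presentation_def)
  obtain \<tau> where \<tau>: "\<tau> \<in> hom G (GL TYPE(int) r)" "\<And>i. i < r \<Longrightarrow> \<tau> (w i) = refl_int r m i"
    using tits_int_ex1[OF ra] by auto
  have \<tau>c: "\<tau> g \<in> carrier_mat r r" if "g \<in> carrier G" for g
    using \<tau>(1) that by (auto simp: hom_def GL_carrier)
  define \<rho> where "\<rho> = (\<lambda>g \<in> carrier G. map_mat real_of_int (\<tau> g))"
  have "(\<lambda>g. map_mat real_of_int (\<tau> g)) \<in> hom G (GL TYPE(real) r)"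
    using Group.hom_compose[OF \<tau>(1) map_mat_GL_hom] by (simp add: comp_def)
  then have "\<rho> \<in> hom G (GL TYPE(real) r)"
    using group.is_monoid[OF G] by (auto simp: \<rho>_def hom_def monoid.m_closed)
  then have \<rho>: "?P \<rho>" using \<tau> w tits_reflection_mat_int[OF ra] by (auto simp: \<rho>_def)
  have rel: "eval_word (GL TYPE(real) r) (tits_reflection_mat r m) x = \<one>\<^bsub>GL TYPE(real) r\<^esub>"
    if x: "x \<in> coxeter_relators r m" "x \<in> words {..<r}" for x
  proof -
    have f: "refl_int r m \<in> {..<r} \<rightarrow> carrier (GL TYPE(int) r)" using refl_int_GL[OF ra] by auto
    have "map_mat real_of_int (eval_word (GL TYPE(int) r) (refl_int r m) x) =
        eval_word (GL TYPE(real) r) (\<lambda>i. map_mat real_of_int (refl_int r m i)) x"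
      by (rule hom_eval_word[OF group_GL group_GL map_mat_GL_hom f x(2)])
    moreover have "eval_word (GL TYPE(real) r) (\<lambda>i. map_mat real_of_int (refl_int r m i)) x =
        eval_word (GL TYPE(real) r) (tits_reflection_mat r m) x"
      using x(2) by (induction x) (auto simp: words_def tits_reflection_mat_int[OF ra])
    ultimately show ?thesis using refl_int_relator[OF ra x(1)] by (simp add: of_int_hom.mat_hom_one)
  qed
  have T: "tits_reflection_mat r m \<in> {..<r} \<rightarrow> carrier (GL TYPE(real) r)"
    using refl_int_GL[OF ra] hom_in_carrier[OF map_mat_GL_hom] tits_reflection_mat_int[OF ra]
    by auto
  show ex1: ?A using has_presentation_hom[OF pres group_GL T rel] by (simp add: Ball_def)
  have tr: "tits_rep G r w m = \<rho>"
    unfolding tits_rep_def by (rule the1_equality[OF ex1, OF \<rho>])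
  have ti: "tits_rep_int G r w m g = \<tau> g" if g: "g \<in> carrier G" for g
    unfolding tits_rep_int_def tr
  proof (rule the_equality)
    fix A assume A: "A \<in> carrier_mat r r \<and> map_mat real_of_int A = \<rho> g"
    then have "map_mat real_of_int A = map_mat real_of_int (\<tau> g)" using g by (simp add: \<rho>_def)
    then show "A = \<tau> g" by (rule of_int_hom.mat_hom_inj)
  qed (use g \<tau>c in \<open>simp add: \<rho>_def\<close>)
  show "map_mat real_of_int (tits_rep_int G r w m g) = tits_rep G r w m g" if "g \<in> carrier G"
    using ti[OF that] that by (simp add: tr \<rho>_def)
  show "tits_rep_int G r w m \<in> hom G (GL TYPE(int) r)"
    using \<tau>(1) ti group.is_monoid[OF G] by (auto simp: hom_def monoid.m_closed)
  show "tits_rep_int G r w m (w i) = refl_int r m i" if "i < r"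
    using ti[OF w[OF that]] \<tau>(2)[OF that] by simp
qed

section \<open>Reduction modulo \<open>k\<close> is a homomorphism\<close>

lemma mat_mod_carrier [simp]: "mat_mod k A \<in> carrier_mat p q \<longleftrightarrow> A \<in> carrier_mat p q"
  by (simp add: mat_mod_def)

lemma sum_mod_cong:
  fixes f g :: "'c \<Rightarrow> int"
  assumes "\<And>x. x \<in> A \<Longrightarrow> f x mod k = g x mod k"
  shows "sum f A mod k = sum g A mod k"
  using mod_sum_eq[of f k A] mod_sum_eq[of g k A] assms by (simp cong: sum.cong)

lemma mat_mod_mult:
  assumes "A \<in> carrier_mat r r" "B \<in> carrier_mat r r"
  shows "mat_mod k (mat_mod k A * B) = mat_mod k (A * B)"
    and "mat_mod k (A * mat_mod k B) = mat_mod k (A * B)"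
proof -
  show "mat_mod k (mat_mod k A * B) = mat_mod k (A * B)"
    by (rule eq_matI)
      (use assms in \<open>auto simp: mat_mod_def scalar_prod_def mod_mult_left_eq
        intro!: sum_mod_cong\<close>)
  show "mat_mod k (A * mat_mod k B) = mat_mod k (A * B)"
    by (rule eq_matI)
      (use assms in \<open>auto simp: mat_mod_def scalar_prod_def mod_mult_right_eq
        intro!: sum_mod_cong\<close>)
qed

lemma mat_mod_idem [simp]: "mat_mod k (mat_mod k A) = mat_mod k A"
  by (rule eq_matI) (auto simp: mat_mod_def)

lemma residue_mat_monoid_carrier:
  assumes "k > 0"
  shows "A \<in> carrier (residue_mat_monoid r k) \<longleftrightarrow> A \<in> carrier_mat r r \<and> mat_mod k A = A"
proof
  assume "A \<in> carrier (residue_mat_monoid r k)"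
  then show "A \<in> carrier_mat r r \<and> mat_mod k A = A"
    by (auto simp: residue_mat_monoid_def mat_mod_def intro!: eq_matI)
next
  assume A: "A \<in> carrier_mat r r \<and> mat_mod k A = A"
  then have carr: "A \<in> carrier_mat r r" by simp
  have "A $$ (i, j) \<in> {0..<int k}" if "i < r" "j < r" for i j
  proof -
    have "A $$ (i, j) = mat_mod k A $$ (i, j)" using A by simp
    also have "\<dots> = A $$ (i, j) mod int k" using carr that by (simp add: mat_mod_def)
    finally show ?thesis
      using assms pos_mod_bound[of "int k" "A $$ (i, j)"] pos_mod_sign[of "int k" "A $$ (i, j)"] by simp
  qed
  then show "A \<in> carrier (residue_mat_monoid r k)" using A by (simp add: residue_mat_monoid_def)
qed

lemma residue_mat_monoid_mult: "A \<otimes>\<^bsub>residue_mat_monoid r k\<^esub> B = mat_mod k (A * B)"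
  and residue_mat_monoid_one: "\<one>\<^bsub>residue_mat_monoid r k\<^esub> = mat_mod k (1\<^sub>m r)"
  by (simp_all add: residue_mat_monoid_def)

lemma monoid_residue_mat_monoid:
  assumes "k > 0" shows "monoid (residue_mat_monoid r k)"
proof (unfold_locales; simp only: residue_mat_monoid_carrier[OF assms] residue_mat_monoid_mult residue_mat_monoid_one)
  fix A B C
  assume "A \<in> carrier_mat r r \<and> mat_mod k A = A" "B \<in> carrier_mat r r \<and> mat_mod k B = B"
    "C \<in> carrier_mat r r \<and> mat_mod k C = C"
  then have A: "A \<in> carrier_mat r r" and B: "B \<in> carrier_mat r r" and C: "C \<in> carrier_mat r r"
    by auto
  show "mat_mod k (mat_mod k (A * B) * C) = mat_mod k (A * mat_mod k (B * C))"
    using mat_mod_mult(1)[of "A * B" r C k] mat_mod_mult(2)[of A r "B * C" k] assoc_mult_mat[OF A B C]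
      A B C by simp
next
  fix A assume "A \<in> carrier_mat r r \<and> mat_mod k A = A"
  then show "mat_mod k (mat_mod k (1\<^sub>m r) * A) = A" "mat_mod k (A * mat_mod k (1\<^sub>m r)) = A"
    using mat_mod_mult(1)[of "1\<^sub>m r" r A k] mat_mod_mult(2)[of A r "1\<^sub>m r" k]
      left_mult_one_mat[of A r r] right_mult_one_mat[of A r r] by auto
qed auto

lemma group_GL_residue: "k > 0 \<Longrightarrow> group (GL_residue r k)"
  unfolding GL_residue_def by (rule monoid.units_group[OF monoid_residue_mat_monoid])

lemma mat_mod_GL_hom:
  assumes "k > 0"
  shows "mat_mod k \<in> hom (GL TYPE(int) r) (GL_residue r k)"
proof (rule homI)
  fix A :: "int mat" assume "A \<in> carrier (GL TYPE(int) r)"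
  then obtain B where "A \<in> carrier_mat r r" "B \<in> carrier_mat r r" "B * A = 1\<^sub>m r" "A * B = 1\<^sub>m r"
    by (auto simp: GL_carrier)
  then show "mat_mod k A \<in> carrier (GL_residue r k)"
    unfolding GL_residue_def units_of_carrier Units_def mem_Collect_eq
      residue_mat_monoid_carrier[OF assms] residue_mat_monoid_mult residue_mat_monoid_one
    by (auto simp: residue_mat_monoid_carrier[OF assms] mat_mod_mult[where r = r]
      intro!: bexI[of _ "mat_mod k B"])
next
  fix A B :: "int mat" assume "A \<in> carrier (GL TYPE(int) r)" "B \<in> carrier (GL TYPE(int) r)"
  then show "mat_mod k (A \<otimes>\<^bsub>GL TYPE(int) r\<^esub> B) = mat_mod k A \<otimes>\<^bsub>GL_residue r k\<^esub> mat_mod k B"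
    by (simp add: GL_residue_def units_of_mult residue_mat_monoid_mult GL_carrier mat_mod_mult[where r = r])
qed

end

theory Submission
  imports Defs
begin

text \<open>
  Let \<open>c\<^sub>k\<close> be the number of letters with index \<open>k\<close> in a word \<open>u\<close>, formal inverses included. A
  generator acts as \<open>1 - 2 E\<^sub>i G\<close>, where \<open>G\<close> is the integral Gram matrix and \<open>E\<^sub>i\<close> the
  matrix unit at \<open>(i, i)\<close>. Modulo \<open>4\<close> all products of two terms \<open>2 E\<^sub>i G\<close> vanish, so the element
  represented by \<open>u\<close> acts as \<open>1 - 2 diag(c) G\<close> (lemma \<open>tits_rep_int_mod_4\<close>). This is the
  identity modulo \<open>2\<close>, whence \<open>W[2] = W\<close>.

  Since the diagonal of \<open>G\<close> consists of ones, the matrix is the identity modulo \<open>4\<close> exactly when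
  all the counts are even (lemma \<open>eval_word_in_congruence_subgroup_4_iff\<close>). A commutator has a word
  in which every letter of two words occurs twice, up to inversion; its counts are even, and so
  \<open>W' \<subseteq> W[4]\<close>. Conversely, let all the counts of a word be even. The generators are
  involutions, so up to commutators the letters can be brought together and cancelled in pairs
  (lemma \<open>eval_word_even_in_derived\<close>), and the element lies in \<open>W'\<close>; thus \<open>W[4] \<subseteq> W'\<close>.
\<close>

section \<open>Words in involutions and the derived subgroup\<close>

lemma (in group) derived_subset_of_subgroup:
  assumes "subgroup H G"
    and "\<And>a b. a \<in> carrier G \<Longrightarrow> b \<in> carrier G \<Longrightarrow> a \<otimes> b \<otimes> inv a \<otimes> inv b \<in> H"
  shows "derived G (carrier G) \<subseteq> H"
  unfolding derived_def by (rule generate_subgroup_incl[OF _ assms(1)]) (use assms(2) in auto)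

text \<open>Pair the first letter with another one of the same index: if \<open>f i\<close> is an involution, then
  \<open>f i \<otimes> a \<otimes> f i \<otimes> b\<close> is the commutator of \<open>f i\<close> and \<open>a\<close> times \<open>a \<otimes> b\<close>, and the word of
  \<open>a \<otimes> b\<close> is shorter by two letters of the same index.\<close>

lemma (in group) eval_word_even_in_derived:
  assumes f: "f \<in> I \<rightarrow> carrier G" and invol: "\<And>i. i \<in> I \<Longrightarrow> f i \<otimes> f i = \<one>"
    and "u \<in> words I" and "\<And>i. even (count_list (map fst u) i)"
  shows "eval_word G f u \<in> derived G (carrier G)"
  using assms(3,4)
proof (induction u rule: length_induct)
  case (1 u)
  have sub: "subgroup (derived G (carrier G)) G"
    using derived_is_subgroup[of "carrier G"] by simp
  show ?case
  proof (cases u)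
    case Nil
    then show ?thesis using subgroup.one_closed[OF sub] by simp
  next
    case (Cons p v)
    obtain i b where p: "p = (i, b)" by (cases p)
    have i: "i \<in> I" and v: "v \<in> words I" using "1.prems"(1) by (auto simp: Cons p words_def)
    have fi: "f i \<in> carrier G" using f i by auto
    then have inv_fi: "inv (f i) = f i" using invol[OF i] by (intro inv_equality)
    have "odd (count_list (map fst v) i)" using "1.prems"(2)[of i] by (simp add: Cons p)
    then have "i \<in> set (map fst v)" by (metis count_list_0_iff even_zero)
    then obtain c where "(i, c) \<in> set v" by auto
    then obtain v1 v2 where v12: "v = v1 @ (i, c) # v2" by (meson split_list)
    have v1: "v1 \<in> words I" and v2: "v2 \<in> words I" and icv2: "(i, c) # v2 \<in> words I"
      using v by (auto simp: v12 words_def)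
    have "even (count_list (map fst (v1 @ v2)) k)" for k
      using "1.prems"(2)[of k] by (auto simp: Cons p v12 split: if_splits)
    then have IH: "eval_word G f (v1 @ v2) \<in> derived G (carrier G)"
      using "1.IH" v1 v2 by (simp add: Cons v12)
    let ?a = "eval_word G f v1" and ?b = "eval_word G f v2"
    have a: "?a \<in> carrier G" and b: "?b \<in> carrier G"
      using eval_word_closed[OF f] v1 v2 by auto
    have "eval_word G f u = f i \<otimes> (?a \<otimes> (f i \<otimes> ?b))"
      using eval_word_append[OF f v1 icv2] by (simp add: Cons p v12 inv_fi)
    also have "\<dots> = (f i \<otimes> ?a \<otimes> inv (f i) \<otimes> inv ?a) \<otimes> (?a \<otimes> ?b)"
    proof -
      have "inv ?a \<otimes> (?a \<otimes> ?b) = ?b" using a b by (simp flip: m_assoc)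
      then show ?thesis using a b fi by (simp add: m_assoc inv_fi)
    qed
    also have "\<dots> = (f i \<otimes> ?a \<otimes> inv (f i) \<otimes> inv ?a) \<otimes> eval_word G f (v1 @ v2)"
      using eval_word_append[OF f v1 v2] by simp
    also have "\<dots> \<in> derived G (carrier G)"
    proof (rule subgroup.m_closed[OF sub _ IH])
      show "f i \<otimes> ?a \<otimes> inv (f i) \<otimes> inv ?a \<in> derived G (carrier G)"
        unfolding derived_def by (rule generate.incl) (use a fi in auto)
    qed
    finally show ?thesis .
  qed
qed

section \<open>The Tits representation modulo 4\<close>

lemma coxeter_generator_square:
  assumes "coxeter_system G r w m" "i < r"
  shows "w i \<otimes>\<^bsub>G\<^esub> w i = \<one>\<^bsub>G\<^esub>"
proof -
  have pres: "has_presentation G {..<r} w (coxeter_relators r m)" and mii: "m i i = enat 1"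
    using assms by (auto simp: coxeter_system_def coxeter_matrix_def one_enat_def)
  interpret group G using pres by (simp add: has_presentation_def)
  have wi: "w i \<in> carrier G" using pres assms(2) by (auto simp: has_presentation_def)
  let ?x = "[(i, True), (i, True)]"
  have x: "?x \<in> words {..<r}" using assms(2) by (simp add: words_def)
  have "?x = concat (replicate 1 [(i, True), (i, True)])" by simp
  then have "?x \<in> coxeter_relators r m"
    using mii assms(2) unfolding coxeter_relators_def by blast
  then have "word_eq {..<r} (coxeter_relators r m) ([] @ ?x @ []) ([] @ [])"
    by (intro word_eq.relator x) (auto simp: words_def)
  then have "eval_word G w ?x = \<one>\<^bsub>G\<^esub>"
    using pres x unfolding has_presentation_def append_Nil append_Nil2 by blast
  then show ?thesis using wi by simp
qed

lemma right_angled_inv_generator: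
  assumes ra: "right_angled_coxeter_system G r w m" and i: "i < r"
  shows "inv\<^bsub>G\<^esub> (w i) = w i"
proof -
  have cs: "coxeter_system G r w m" using ra by (simp add: right_angled_coxeter_system_def)
  interpret group G using cs by (simp add: coxeter_system_def has_presentation_def)
  show ?thesis
    using coxeter_generator_square[OF cs i] cs i
    by (auto simp: coxeter_system_def has_presentation_def intro!: inv_equality)
qed

lemma even_diff_of_dvd_4: "4 dvd a - (d - 2 * c) \<Longrightarrow> even (a - d)" for a c d :: int
  by presburger

lemma dvd_4_diff_iff_even: "4 dvd a - (d - 2 * c) \<Longrightarrow> 4 dvd a - d \<longleftrightarrow> even c" for a c d :: int
  by presburger

lemma refl_int_mult_entry:
  assumes "A \<in> carrier_mat r r" "k < r" "l < r"
  shows "(refl_int r m i * A) $$ (k, l) =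
    A $$ (k, l) - (if k = i then 2 * (\<Sum>x<r. gram_int m i x * A $$ (x, l)) else 0)"
proof -
  have "(refl_int r m i * A) $$ (k, l) =
      (\<Sum>x<r. ((if k = x then 1 else 0) - (if k = i then 2 * gram_int m i x else 0)) * A $$ (x, l))"
    using assms by (auto simp: refl_int_def scalar_prod_def lessThan_atLeast0 intro!: sum.cong)
  also have "\<dots> = (\<Sum>x<r. (if x = k then A $$ (k, l) else 0)
      - (if k = i then 2 * (gram_int m i x * A $$ (x, l)) else 0))"
    by (rule sum.cong) (auto simp: algebra_simps)
  also have "\<dots> = A $$ (k, l) - (if k = i then 2 * (\<Sum>x<r. gram_int m i x * A $$ (x, l)) else 0)"
    using assms by (simp add: sum_subtractf sum_distrib_left)
  finally show ?thesis .
qed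

lemma tits_rep_int_carrier:
  assumes "right_angled_coxeter_system G r w m" "g \<in> carrier G"
  shows "tits_rep_int G r w m g \<in> carrier_mat r r"
  using hom_in_carrier[OF tits_rep_int_hom[OF assms(1)] assms(2)] by (simp add: GL_carrier)

text \<open>The element of \<open>u\<close> acts as \<open>1 - 2 diag(c) G\<close> modulo \<open>4\<close>. One more reflection subtracts
  \<open>2 E\<^sub>i G A\<close> from the matrix \<open>A\<close> reached so far; as \<open>A\<close> is the identity modulo \<open>2\<close>, this is
  \<open>2 E\<^sub>i G\<close> modulo \<open>4\<close>, which raises the count of \<open>i\<close> by one.\<close>

lemma tits_rep_int_mod_4:
  assumes ra: "right_angled_coxeter_system G r w m" and "u \<in> words {..<r}"
    and "k < r" "l < r"
  shows "4 dvd tits_rep_int G r w m (eval_word G w u) $$ (k, l)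
    - (1\<^sub>m r $$ (k, l) - 2 * (int (count_list (map fst u) k) * gram_int m k l))"
  using assms(2-4)
proof (induction u arbitrary: k l)
  have pres: "has_presentation G {..<r} w (coxeter_relators r m)"
    using ra by (simp add: right_angled_coxeter_system_def coxeter_system_def)
  interpret G: group G using pres by (simp add: has_presentation_def)
  have w: "w \<in> {..<r} \<rightarrow> carrier G" using pres by (simp add: has_presentation_def)
  interpret T: group_hom G "GL TYPE(int) r" "tits_rep_int G r w m"
    using tits_rep_int_hom[OF ra] group_GL
    by (simp add: group_hom_def group_hom_axioms_def G.group_axioms)
  {
    case Nil
    then show ?case using T.hom_one by simp
  next
    case (Cons p u)
    obtain i b where p: "p = (i, b)" by (cases p)
    have i: "i < r" and u: "u \<in> words {..<r}" using Cons.prems by (auto simp: p words_def)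
    have wi: "w i \<in> carrier G" using w i by auto
    define A where "A = tits_rep_int G r w m (eval_word G w u)"
    have g: "eval_word G w u \<in> carrier G" using G.eval_word_closed[OF w u] .
    have A: "A \<in> carrier_mat r r" unfolding A_def by (rule tits_rep_int_carrier[OF ra g])
    have prod: "tits_rep_int G r w m (eval_word G w (p # u)) = refl_int r m i * A"
      using wi g tits_rep_int_gen[OF ra i] by (simp add: p right_angled_inv_generator[OF ra i] A_def)
    have IH: "4 dvd A $$ (x, y)
        - (1\<^sub>m r $$ (x, y) - 2 * (int (count_list (map fst u) x) * gram_int m x y))"
      if "x < r" "y < r" for x y
      using Cons.IH[OF u that] by (simp add: A_def)
    have even: "2 dvd A $$ (x, y) - 1\<^sub>m r $$ (x, y)" if "x < r" "y < r" for x y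
      using even_diff_of_dvd_4[OF IH[OF that]] .
    have "(\<Sum>x<r. gram_int m i x * 1\<^sub>m r $$ (x, l)) = gram_int m i l"
      using Cons.prems by (simp add: if_distrib cong: if_cong)
    then have "(\<Sum>x<r. gram_int m i x * A $$ (x, l)) - gram_int m i l =
        (\<Sum>x<r. gram_int m i x * (A $$ (x, l) - 1\<^sub>m r $$ (x, l)))"
      by (simp add: right_diff_distrib sum_subtractf)
    also have "2 dvd \<dots>" using even Cons.prems by (intro dvd_sum dvd_mult) simp
    finally obtain t
      where sum_row: "(\<Sum>x<r. gram_int m i x * A $$ (x, l)) = gram_int m i l + 2 * t"
      by (metis add.commute diff_add_cancel dvdE)
    show ?case
    proof (cases "k = i")
      case True
      let ?g = "gram_int m k l" and ?c = "int (count_list (map fst u) k)"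
      have "A $$ (k, l) - 2 * (?g + 2 * t) - (1\<^sub>m r $$ (k, l) - 2 * ((?c + 1) * ?g)) =
          A $$ (k, l) - (1\<^sub>m r $$ (k, l) - 2 * (?c * ?g)) - 4 * t"
        by (simp add: algebra_simps)
      also have "4 dvd \<dots>" by (rule dvd_diff[OF IH[OF Cons.prems(2,3)] dvd_triv_left])
      finally have "4 dvd A $$ (k, l) - 2 * (?g + 2 * t) - (1\<^sub>m r $$ (k, l) - 2 * ((?c + 1) * ?g))" .
      moreover have "int (count_list (map fst (p # u)) k) = ?c + 1" using True by (simp add: p)
      ultimately show ?thesis
        unfolding prod refl_int_mult_entry[OF A Cons.prems(2,3)] using sum_row True
        by (simp only: simp_thms if_True)
    next
      case False
      then show ?thesis
        using IH[OF Cons.prems(2,3)] unfolding prod refl_int_mult_entry[OF A Cons.prems(2,3)]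
        by (simp add: p)
    qed
  }
qed

section \<open>Congruence subgroups of level 2 and 4\<close>

lemma mem_congruence_subgroup_iff:
  assumes ra: "right_angled_coxeter_system G r w m" and g: "g \<in> carrier G"
  shows "g \<in> congruence_subgroup G r w m n \<longleftrightarrow>
    (\<forall>k<r. \<forall>l<r. int n dvd tits_rep_int G r w m g $$ (k, l) - 1\<^sub>m r $$ (k, l))"
proof -
  let ?A = "tits_rep_int G r w m g"
  have "g \<in> congruence_subgroup G r w m n \<longleftrightarrow> mat_mod n ?A = mat_mod n (1\<^sub>m r)"
    using g by (simp add: congruence_subgroup_def kernel_def GL_residue_def units_of_one
        residue_mat_monoid_one)
  also have "\<dots> \<longleftrightarrow> (\<forall>k<r. \<forall>l<r. ?A $$ (k, l) mod int n = 1\<^sub>m r $$ (k, l) mod int n)"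
    using tits_rep_int_carrier[OF ra g] by (auto simp: mat_mod_def mat_eq_iff)
  finally show ?thesis by (simp add: mod_eq_dvd_iff)
qed

lemma subgroup_congruence_subgroup:
  assumes ra: "right_angled_coxeter_system G r w m" and "n > 0"
  shows "subgroup (congruence_subgroup G r w m n) G"
proof -
  have G: "group G"
    using ra by (simp add: right_angled_coxeter_system_def coxeter_system_def has_presentation_def)
  have "(\<lambda>g. mat_mod n (tits_rep_int G r w m g)) \<in> hom G (GL_residue r n)"
    using Group.hom_compose[OF tits_rep_int_hom[OF ra] mat_mod_GL_hom[OF assms(2)]]
    by (simp add: comp_def)
  then show ?thesis
    unfolding congruence_subgroup_def
    by (intro group_hom.subgroup_kernel)
      (simp add: group_hom_def group_hom_axioms_def G group_GL_residue[OF assms(2)])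
qed

text \<open>The off-diagonal entries of \<open>diag(c) G\<close> are multiples of the \<open>c\<^sub>k\<close>, which are its diagonal
  entries; hence \<open>2 diag(c) G\<close> vanishes modulo \<open>4\<close> exactly when every \<open>c\<^sub>k\<close> is even.\<close>

lemma eval_word_in_congruence_subgroup_4_iff:
  assumes ra: "right_angled_coxeter_system G r w m" and u: "u \<in> words {..<r}"
  shows "eval_word G w u \<in> congruence_subgroup G r w m 4 \<longleftrightarrow>
    (\<forall>k. even (count_list (map fst u) k))"
proof -
  have pres: "has_presentation G {..<r} w (coxeter_relators r m)"
    using ra by (simp add: right_angled_coxeter_system_def coxeter_system_def)
  interpret group G using pres by (simp add: has_presentation_def)
  have g: "eval_word G w u \<in> carrier G"
    using eval_word_closed[OF _ u] pres by (simp add: has_presentation_def)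
  let ?A = "tits_rep_int G r w m (eval_word G w u)" and ?c = "\<lambda>k. int (count_list (map fst u) k)"
  have entry: "4 dvd ?A $$ (k, l) - 1\<^sub>m r $$ (k, l) \<longleftrightarrow> even (?c k * gram_int m k l)"
    if "k < r" "l < r" for k l
    using dvd_4_diff_iff_even[OF tits_rep_int_mod_4[OF ra u that]] .
  have diag: "gram_int m k k = 1" if "k < r" for k
    using right_angled_values[OF ra that that] by (simp add: gram_int_def)
  have "eval_word G w u \<in> congruence_subgroup G r w m 4 \<longleftrightarrow>
      (\<forall>k<r. \<forall>l<r. even (?c k * gram_int m k l))"
    using mem_congruence_subgroup_iff[OF ra g, of 4] entry by simp
  also have "\<dots> \<longleftrightarrow> (\<forall>k<r. even (?c k))"
    using diag by (metis even_mult_iff mult.right_neutral)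
  also have "\<dots> \<longleftrightarrow> (\<forall>k. even (count_list (map fst u) k))"
  proof -
    have "count_list (map fst u) k = 0" if "\<not> k < r" for k
      using u that by (auto simp: count_list_0_iff words_def)
    then show ?thesis by (metis even_of_nat even_zero)
  qed
  finally show ?thesis .
qed

theorem proposition3p5:
  fixes W :: "('a, 'b) monoid_scheme"
    and r :: nat and w :: "nat \<Rightarrow> 'a" and m :: "nat \<Rightarrow> nat \<Rightarrow> enat"
  assumes "right_angled_coxeter_system W r w m"
  shows "congruence_subgroup W r w m 2 = carrier W \<and>
         congruence_subgroup W r w m 4 = derived W (carrier W)"
proof -
  note ra = assms
  have cs: "coxeter_system W r w m" using ra by (simp add: right_angled_coxeter_system_def)
  then have pres: "has_presentation W {..<r} w (coxeter_relators r m)"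
    by (simp add: coxeter_system_def)
  interpret group W using pres by (simp add: has_presentation_def)
  have w: "w \<in> {..<r} \<rightarrow> carrier W" using pres by (simp add: has_presentation_def)
  have sub: "congruence_subgroup W r w m n \<subseteq> carrier W" for n
    by (auto simp: congruence_subgroup_def kernel_def)
  have word: "\<exists>u \<in> words {..<r}. g = eval_word W w u" if "g \<in> carrier W" for g
    using generate_eval_word[OF w] pres that by (simp add: has_presentation_def)
  have "g \<in> congruence_subgroup W r w m 2" if g: "g \<in> carrier W" for g
  proof -
    obtain u where u: "u \<in> words {..<r}" "g = eval_word W w u" using word[OF g] by auto
    have "2 dvd tits_rep_int W r w m g $$ (k, l) - 1\<^sub>m r $$ (k, l)" if "k < r" "l < r" for k l
      using even_diff_of_dvd_4[OF tits_rep_int_mod_4[OF ra u(1) that]] by (simp only: u(2))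
    then show ?thesis using mem_congruence_subgroup_iff[OF ra g, of 2] by simp
  qed
  moreover have "congruence_subgroup W r w m 4 \<subseteq> derived W (carrier W)"
  proof
    fix g assume g: "g \<in> congruence_subgroup W r w m 4"
    then obtain u where u: "u \<in> words {..<r}" "g = eval_word W w u" using word sub by blast
    then show "g \<in> derived W (carrier W)"
      using g eval_word_in_congruence_subgroup_4_iff[OF ra u(1)]
        eval_word_even_in_derived[OF w _ u(1)] coxeter_generator_square[OF cs] by simp
  qed
  moreover have "derived W (carrier W) \<subseteq> congruence_subgroup W r w m 4"
  proof (rule derived_subset_of_subgroup[OF subgroup_congruence_subgroup[OF ra]])
    fix a b assume "a \<in> carrier W" "b \<in> carrier W"
    then obtain u v where uv: "u \<in> words {..<r}" "a = eval_word W w u"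
      "v \<in> words {..<r}" "b = eval_word W w v"
      using word by meson
    let ?x = "u @ v @ inv_word u @ inv_word v"
    have x: "?x \<in> words {..<r}" using uv by (simp add: inv_word_in_words)
    have "map fst (inv_word u) = rev (map fst u)" for u :: "nat word"
      by (simp add: inv_word_def rev_map case_prod_unfold)
    then have "even (count_list (map fst ?x) k)" for k by auto
    moreover have "eval_word W w ?x = a \<otimes>\<^bsub>W\<^esub> b \<otimes>\<^bsub>W\<^esub> inv\<^bsub>W\<^esub> a \<otimes>\<^bsub>W\<^esub> inv\<^bsub>W\<^esub> b"
      using uv eval_word_closed[OF w]
      by (simp add: eval_word_append[OF w] eval_word_inv[OF w] inv_word_in_words m_assoc)
    ultimately show "a \<otimes>\<^bsub>W\<^esub> b \<otimes>\<^bsub>W\<^esub> inv\<^bsub>W\<^esub> a \<otimes>\<^bsub>W\<^esub> inv\<^bsub>W\<^esub> b \<in> congruence_subgroup W r w m 4"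
      using eval_word_in_congruence_subgroup_4_iff[OF ra x] by simp
  qed simp
  ultimately show ?thesis using sub by blast
qed

end
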